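(* Let $\mathcal{W}^F$ be a trained Wilson network with $m$ rows and $n$ columns, where $F$ consists of either one pattern or two distinct patterns. Then every balanced coloring of $\mathcal{W}^F$ is an orbit coloring, i.e. its color classes are exactly the orbits of some subgroup of the automorphism group $\mathrm{aut}(\mathcal{W}^F)$.
   Context: Let $M=\{1,\dots,m\}$, $N=\{1,\dots,n\}$; nodes are the pairs $(i,j)\in M\times N$, all of the same type. The untrained Wilson network $\mathcal{W}$ has, for every ordered pair of distinct nodes in the same column, exactly one arrow of a single "inhibitory" type, and no other arrows. A pattern is determined by a function $g:N\to M$; its node set is $\mathcal{C}^g=\{(g(j),j):j\in N\}$ (one node from each column). Two patterns are distinct if their functions differ. For a set $F$ of patterns, the trained Wilson network $\mathcal{W}^F$ is obtained from $\mathcal{W}$ by adding, for each pattern $g\in F$, one arrow of a second "excitatory" type from each node of $\mathcal{C}^g$ to each other node of $\mathcal{C}^g$; the excitatory arrows are of the same type for all patterns, and arrows from different patterns are counted separately (so two nodes lying in two common patterns are joined by two excitatory arrows in each direction). The automorphism group $\mathrm{aut}(\mathcal{W}^F)$ consists of the node permutations preserving, for every ordered pair of nodes, the number of arrows of each type between them. A coloring is a partition of the nodes into color classes; it is balanced if whenever nodes $c,d$ have the same color, for each arrow type and each color $k$ the number of input arrows of that type to $c$ (counted with multiplicity) whose tail has color $k$ equals the corresponding number for $d$. *)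

theory Defs
  imports Main "HOL-Library.FuncSet" "HOL-Combinatorics.Permutations"
begin

text \<open>Nodes of the Wilson network with m rows and n columns: pairs (i,j),
  i in {1..m} (row), j in {1..n} (column).\<close>
definition wnodes :: "nat \<Rightarrow> nat \<Rightarrow> (nat \<times> nat) set" where
  "wnodes m n = {1..m} \<times> {1..n}"

definition patterns :: "nat \<Rightarrow> nat \<Rightarrow> (nat \<Rightarrow> nat) set" where
  "patterns m n = {1..n} \<rightarrow>\<^sub>E {1..m}"

definition pattern_nodes :: "nat \<Rightarrow> (nat \<Rightarrow> nat) \<Rightarrow> (nat \<times> nat) set" where
  "pattern_nodes n g = {(g j, j) | j. j \<in> {1..n}}"

definition inh_arrows :: "nat \<times> nat \<Rightarrow> nat \<times> nat \<Rightarrow> nat" where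
  "inh_arrows a b = (if a \<noteq> b \<and> snd a = snd b then 1 else 0)"

definition exc_arrows :: "nat \<Rightarrow> (nat \<Rightarrow> nat) set \<Rightarrow> nat \<times> nat \<Rightarrow> nat \<times> nat \<Rightarrow> nat" where
  "exc_arrows n F a b =
     card {g \<in> F. a \<noteq> b \<and> a \<in> pattern_nodes n g \<and> b \<in> pattern_nodes n g}"

definition wilson_aut :: "nat \<Rightarrow> nat \<Rightarrow> (nat \<Rightarrow> nat) set \<Rightarrow> ((nat \<times> nat) \<Rightarrow> (nat \<times> nat)) set" where
  "wilson_aut m n F =
     {\<sigma>. \<sigma> permutes wnodes m n \<and>
          (\<forall>a\<in>wnodes m n. \<forall>b\<in>wnodes m n.
              inh_arrows (\<sigma> a) (\<sigma> b) = inh_arrows a b \<and>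
              exc_arrows n F (\<sigma> a) (\<sigma> b) = exc_arrows n F a b)}"

definition balanced :: "nat \<Rightarrow> nat \<Rightarrow> (nat \<Rightarrow> nat) set \<Rightarrow> (nat \<times> nat \<Rightarrow> 'c) \<Rightarrow> bool" where
  "balanced m n F col \<longleftrightarrow>
     (\<forall>c\<in>wnodes m n. \<forall>d\<in>wnodes m n. col c = col d \<longrightarrow>
        (\<forall>k. (\<Sum>e\<in>{e\<in>wnodes m n. col e = k}. inh_arrows e c)
              = (\<Sum>e\<in>{e\<in>wnodes m n. col e = k}. inh_arrows e d)
           \<and> (\<Sum>e\<in>{e\<in>wnodes m n. col e = k}. exc_arrows n F e c)
              = (\<Sum>e\<in>{e\<in>wnodes m n. col e = k}. exc_arrows n F e d)))"

definition aut_subgroup :: "nat \<Rightarrow> nat \<Rightarrow> (nat \<Rightarrow> nat) set \<Rightarrow> ((nat \<times> nat) \<Rightarrow> (nat \<times> nat)) set \<Rightarrow> bool" where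
  "aut_subgroup m n F H \<longleftrightarrow>
     H \<subseteq> wilson_aut m n F \<and> id \<in> H \<and>
     (\<forall>\<sigma>\<in>H. \<forall>\<tau>\<in>H. \<sigma> \<circ> \<tau> \<in> H) \<and> (\<forall>\<sigma>\<in>H. inv \<sigma> \<in> H)"

definition orbit_coloring :: "nat \<Rightarrow> nat \<Rightarrow> (nat \<Rightarrow> nat) set \<Rightarrow> (nat \<times> nat \<Rightarrow> 'c) \<Rightarrow> bool" where
  "orbit_coloring m n F col \<longleftrightarrow>
     (\<exists>H. aut_subgroup m n F H \<and>
        (\<forall>c\<in>wnodes m n. \<forall>d\<in>wnodes m n. col c = col d \<longleftrightarrow> (\<exists>\<sigma>\<in>H. \<sigma> c = d)))"

end

theory Submission
  imports Defs
begin

text \<open>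
  The subgroup is the group of all colour-preserving automorphisms, so what has to be shown is that
  it is transitive on each colour class. Balance for inhibitory arrows says that two columns sharing
  a colour have the same colours with the same multiplicities. If there are at least two columns
  (a single column carries no excitatory arrows), balance for excitatory arrows says that nodes on patterns never share a colour with nodes off them, and that a node lying only on the
  first pattern shares its colour with one lying only on the second only if both patterns use each
  colour equally often. The automorphisms needed permute columns and possibly interchange the two
  patterns simultaneously in all columns; the multiplicities just described are what is needed to
  find colour-preserving ones among them.
\<close>

section \<open>Bijections that respect labels\<close>

text \<open>Fibres over the same label have equal size, so they can be matched one label at a time;
  the matchings glue because fibres over different labels are disjoint.\<close>

lemma ex_label_bij:
  fixes p :: "'a \<Rightarrow> 'l" and q :: "'b \<Rightarrow> 'l"
  assumes fin: "finite X" "finite Y"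
    and cnt: "\<And>l. card {x\<in>X. p x = l} = card {y\<in>Y. q y = l}"
  obtains f where "bij_betw f X Y" "\<And>x. x \<in> X \<Longrightarrow> q (f x) = p x"
proof -
  have "\<exists>f. bij_betw f {x\<in>X. p x = l} {y\<in>Y. q y = l}" for l
    using fin cnt by (intro finite_same_card_bij) auto
  then obtain F where F: "\<And>l. bij_betw (F l) {x\<in>X. p x = l} {y\<in>Y. q y = l}"
    by metis
  define f where "f x = F (p x) x" for x
  have f: "f x \<in> Y" "q (f x) = p x" if "x \<in> X" for x
    using bij_betwE[OF F[of "p x"]] that by (auto simp: f_def)
  have "inj_on f X"
  proof (rule inj_onI)
    fix x y assume xy: "x \<in> X" "y \<in> X" "f x = f y"
    then have "p x = p y" by (metis f(2))
    then show "x = y"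
      using xy inj_onD[OF bij_betw_imp_inj_on[OF F[of "p x"]], of x y] by (auto simp: f_def)
  qed
  moreover have "y \<in> f ` X" if "y \<in> Y" for y
  proof -
    have "y \<in> F (q y) ` {x\<in>X. p x = q y}"
      using that bij_betw_imp_surj_on[OF F[of "q y"]] by auto
    then show ?thesis by (force simp: f_def)
  qed
  ultimately have "bij_betw f X Y"
    using f(1) by (auto simp: bij_betw_def)
  then show ?thesis using f(2) that by blast
qed

lemma ex_label_bij_extending:
  fixes p :: "'a \<Rightarrow> 'l" and q :: "'b \<Rightarrow> 'l"
  assumes fin: "finite X" "finite Y"
    and cnt: "\<And>l. card {x\<in>X. p x = l} = card {y\<in>Y. q y = l}"
    and S: "S \<subseteq> X" "inj_on f0 S" "f0 ` S \<subseteq> Y" "\<And>x. x \<in> S \<Longrightarrow> q (f0 x) = p x"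
  obtains f where "bij_betw f X Y" "\<And>x. x \<in> X \<Longrightarrow> q (f x) = p x" "\<And>x. x \<in> S \<Longrightarrow> f x = f0 x"
proof -
  have finS: "finite S" using S(1) fin(1) by (rule finite_subset)
  have "card {x\<in>X - S. p x = l} = card {y\<in>Y - f0 ` S. q y = l}" for l
  proof -
    have "{y\<in>f0 ` S. q y = l} = f0 ` {x\<in>S. p x = l}"
      using S(4) by auto
    moreover have "inj_on f0 {x\<in>S. p x = l}"
      using S(2) by (rule inj_on_subset) auto
    ultimately have "card {y\<in>f0 ` S. q y = l} = card {x\<in>S. p x = l}"
      by (simp add: card_image)
    moreover have "{x\<in>X - S. p x = l} = {x\<in>X. p x = l} - {x\<in>S. p x = l}"
      and "{y\<in>Y - f0 ` S. q y = l} = {y\<in>Y. q y = l} - {y\<in>f0 ` S. q y = l}"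
      by auto
    moreover have "{x\<in>S. p x = l} \<subseteq> {x\<in>X. p x = l}" "{y\<in>f0 ` S. q y = l} \<subseteq> {y\<in>Y. q y = l}"
      using S by auto
    ultimately show ?thesis
      using finS cnt[of l] by (simp add: card_Diff_subset)
  qed
  then obtain f1 where f1: "bij_betw f1 (X - S) (Y - f0 ` S)"
      "\<And>x. x \<in> X - S \<Longrightarrow> q (f1 x) = p x"
    using ex_label_bij[of "X - S" "Y - f0 ` S" p q] fin by auto
  define f where "f x = (if x \<in> S then f0 x else f1 x)" for x
  have "bij_betw f S (f0 ` S)"
    using S(2) by (auto simp: f_def bij_betw_def inj_on_def)
  moreover have "bij_betw f (X - S) (Y - f0 ` S)"
    using f1(1) by (rule iffD1[OF bij_betw_cong, rotated]) (auto simp: f_def)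
  ultimately have "bij_betw f (S \<union> (X - S)) (f0 ` S \<union> (Y - f0 ` S))"
    by (rule bij_betw_combine) auto
  moreover have "S \<union> (X - S) = X" "f0 ` S \<union> (Y - f0 ` S) = Y"
    using S by auto
  ultimately have "bij_betw f X Y" by simp
  then show ?thesis
    using f1(2) S(4) by (intro that[of f]) (auto simp: f_def)
qed

section \<open>Nodes, patterns and arrow counts\<close>

lemma finite_wnodes: "finite (wnodes m n)"
  by (simp add: wnodes_def)

lemma mem_pattern_nodes: "(i, j) \<in> pattern_nodes n p \<longleftrightarrow> i = p j \<and> j \<in> {1..n}"
  by (auto simp: pattern_nodes_def)

lemma pattern_node_in_wnodes: "p \<in> patterns m n \<Longrightarrow> j \<in> {1..n} \<Longrightarrow> (p j, j) \<in> wnodes m n"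
  by (auto simp: patterns_def wnodes_def PiE_iff)

lemma pattern_nodes_subset: "p \<in> patterns m n \<Longrightarrow> pattern_nodes n p \<subseteq> wnodes m n"
  by (auto simp: mem_pattern_nodes pattern_node_in_wnodes)

text \<open>The conjunct \<open>g \<noteq> h\<close> keeps a single pattern from being counted twice
  when \<open>{g, h}\<close> is a singleton.\<close>

lemma exc_arrows_two:
  "exc_arrows n {g, h} a b =
    (if a = b then 0
     else of_bool (a \<in> pattern_nodes n g \<and> b \<in> pattern_nodes n g)
        + of_bool (g \<noteq> h \<and> a \<in> pattern_nodes n h \<and> b \<in> pattern_nodes n h))"
proof -
  have "{p \<in> {g, h}. P p} = (if P g then {g} else {}) \<union> (if P h then {h} else {})" for P
    by auto
  then show ?thesis
    by (auto simp: exc_arrows_def)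
qed

section \<open>Orbit colorings from transitivity\<close>

lemma orbit_coloring_if_transitive:
  assumes "\<And>c d. c \<in> wnodes m n \<Longrightarrow> d \<in> wnodes m n \<Longrightarrow> col c = col d \<Longrightarrow>
      \<exists>\<sigma>\<in>wilson_aut m n F. (\<forall>v\<in>wnodes m n. col (\<sigma> v) = col v) \<and> \<sigma> c = d"
  shows "orbit_coloring m n F col"
proof -
  let ?W = "wnodes m n"
  define H where "H = {\<sigma>\<in>wilson_aut m n F. \<forall>v\<in>?W. col (\<sigma> v) = col v}"
  have comp: "\<sigma> \<circ> \<tau> \<in> H" if "\<sigma> \<in> H" "\<tau> \<in> H" for \<sigma> \<tau>
  proof -
    have "\<tau> permutes ?W" "\<sigma> permutes ?W"
      using that by (auto simp: H_def wilson_aut_def)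
    then show ?thesis
      using that permutes_in_image[of \<tau> ?W]
      by (auto simp: H_def wilson_aut_def permutes_compose)
  qed
  have inv: "inv \<sigma> \<in> H" if "\<sigma> \<in> H" for \<sigma>
  proof -
    have p: "\<sigma> permutes ?W" using that by (auto simp: H_def wilson_aut_def)
    note pi = permutes_inv[OF p]
    have in_W: "inv \<sigma> a \<in> ?W" if "a \<in> ?W" for a
      using that permutes_in_image[OF pi] by simp
    \<comment> \<open>Preservation by \<open>\<sigma>\<close> is read at the nodes
      \<open>inv \<sigma> a\<close> and \<open>inv \<sigma> b\<close>, which \<open>\<sigma>\<close>
      sends to \<open>a\<close> and \<open>b\<close>.\<close>
    have "inh_arrows (inv \<sigma> a) (inv \<sigma> b) = inh_arrows a b \<and>
        exc_arrows n F (inv \<sigma> a) (inv \<sigma> b) = exc_arrows n F a b" if "a \<in> ?W" "b \<in> ?W" for a b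
      using \<open>\<sigma> \<in> H\<close> in_W[OF that(1)] in_W[OF that(2)] permutes_inverses(1)[OF p]
      unfolding H_def wilson_aut_def by (smt (verit) mem_Collect_eq)
    moreover have "col (inv \<sigma> a) = col a" if "a \<in> ?W" for a
      using \<open>\<sigma> \<in> H\<close> in_W[OF that] permutes_inverses(1)[OF p]
      unfolding H_def by (smt (verit) mem_Collect_eq)
    ultimately show ?thesis
      using pi by (auto simp: H_def wilson_aut_def)
  qed
  have "id \<in> H" by (auto simp: H_def wilson_aut_def permutes_id)
  then have "aut_subgroup m n F H"
    using comp inv by (auto simp: aut_subgroup_def H_def)
  moreover have "col c = col d \<longleftrightarrow> (\<exists>\<sigma>\<in>H. \<sigma> c = d)" if "c \<in> ?W" "d \<in> ?W" for c d
    using assms[OF that] that by (auto simp: H_def)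
  ultimately show ?thesis
    unfolding orbit_coloring_def by blast
qed

text \<open>Without a second column there are no excitatory arrows, and any two distinct nodes are
  joined by inhibitory ones. Hence every node permutation is an automorphism, and the transposition
  of \<open>c\<close> and \<open>d\<close> serves.\<close>

lemma orbit_coloring_single_column:
  assumes "n \<le> 1"
  shows "orbit_coloring m n F col"
proof (rule orbit_coloring_if_transitive)
  fix c d assume cd: "c \<in> wnodes m n" "d \<in> wnodes m n" "col c = col d"
  let ?t = "Transposition.transpose c d"
  have snd: "snd v = 1" if "v \<in> wnodes m n" for v
    using that assms by (auto simp: wnodes_def)
  have exc: "exc_arrows n F a b = 0" for a b
  proof -
    have "a = b" if "a \<in> pattern_nodes n p" "b \<in> pattern_nodes n p" for p
    proof -
      have "n = 0 \<or> n = 1" using assms by auto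
      then show ?thesis using that by (auto simp: pattern_nodes_def)
    qed
    then have "{p \<in> F. a \<noteq> b \<and> a \<in> pattern_nodes n p \<and> b \<in> pattern_nodes n p} = {}"
      by blast
    then show ?thesis unfolding exc_arrows_def by (simp only: card.empty)
  qed
  have perm: "?t permutes wnodes m n"
    using cd by (auto intro: permutes_swap_id)
  have "inh_arrows (?t a) (?t b) = inh_arrows a b" if "a \<in> wnodes m n" "b \<in> wnodes m n" for a b
  proof -
    have "?t a \<in> wnodes m n" "?t b \<in> wnodes m n"
      using that permutes_in_image[OF perm] by auto
    then show ?thesis
      using that snd inj_eq[OF permutes_inj[OF perm]] by (simp add: inh_arrows_def)
  qed
  then have "?t \<in> wilson_aut m n F"
    using perm exc by (auto simp: wilson_aut_def)
  moreover have "col (?t v) = col v" for v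
    using cd(3) by (auto simp: Transposition.transpose_def)
  ultimately show "\<exists>\<sigma>\<in>wilson_aut m n F. (\<forall>v\<in>wnodes m n. col (\<sigma> v) = col v) \<and> \<sigma> c = d"
    by (intro bexI[of _ ?t]) auto
qed

section \<open>Columns and counting with one node removed\<close>

definition column :: "nat \<Rightarrow> nat \<Rightarrow> (nat \<times> nat) set" where
  "column m j = {1..m} \<times> {j}"

lemma finite_column: "finite (column m j)"
  by (simp add: column_def)

lemma column_subset_wnodes: "j \<in> {1..n} \<Longrightarrow> column m j \<subseteq> wnodes m n"
  by (auto simp: column_def wnodes_def)

lemma mem_column_iff: "v \<in> wnodes m n \<Longrightarrow> v \<in> column m j \<longleftrightarrow> snd v = j"
  by (auto simp: column_def wnodes_def)

lemma wnodes_in_column: "v \<in> wnodes m n \<Longrightarrow> v \<in> column m (snd v)"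
  by (simp add: mem_column_iff)

text \<open>No node has an arrow to itself, so input sums omit \<open>x\<close>. The correction
  depends only on the colour of \<open>x\<close> and is therefore the same for two nodes of equal
  colour.\<close>

lemma card_remove_fibre:
  assumes "finite X" "x \<in> X"
  shows "card {e\<in>X. col e = k} = card {e\<in>X. col e = k \<and> e \<noteq> x} + of_bool (col x = k)"
proof (cases "col x = k")
  case True
  then have "{e\<in>X. col e = k} = insert x {e\<in>X. col e = k \<and> e \<noteq> x}"
    using assms by auto
  then show ?thesis using assms True by simp
next
  case False
  then have "{e\<in>X. col e = k} = {e\<in>X. col e = k \<and> e \<noteq> x}" by auto
  then show ?thesis using False by simp
qed

text \<open>The case of a single pattern is \<open>g = h\<close>.\<close>

locale two_patterns =
  fixes m n :: nat and g h :: "nat \<Rightarrow> nat" and col :: "nat \<times> nat \<Rightarrow> 'c"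
  assumes g: "g \<in> patterns m n" and h: "h \<in> patterns m n"
    and n: "2 \<le> n"
    and bal: "balanced m n {g, h} col"
begin

abbreviation "W \<equiv> wnodes m n"
abbreviation "F \<equiv> {g, h}"

section \<open>Consequences of balance\<close>

lemma pattern_node_in_column: "p \<in> F \<Longrightarrow> j \<in> {1..n} \<Longrightarrow> (p j, j) \<in> column m j"
  using pattern_node_in_wnodes[OF g, of j] pattern_node_in_wnodes[OF h, of j]
  by (auto simp: wnodes_def column_def)

text \<open>The inhibitory inputs of \<open>c\<close> come from the other nodes of its column.
  Adding \<open>c\<close> itself, and \<open>d\<close> on the other side, changes the count for the
  same colour.\<close>

lemma column_color_counts:
  assumes "c \<in> W" "d \<in> W" "col c = col d"
  shows "card {e\<in>column m (snd c). col e = k} = card {e\<in>column m (snd d). col e = k}"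
proof -
  have sum: "(\<Sum>e\<in>{e\<in>W. col e = k}. inh_arrows e x) = card {e\<in>column m (snd x). col e = k \<and> e \<noteq> x}"
    if "x \<in> W" for x
  proof -
    have "(\<Sum>e\<in>{e\<in>W. col e = k}. inh_arrows e x)
        = card {e\<in>{e\<in>W. col e = k}. e \<noteq> x \<and> snd e = snd x}"
      by (simp add: inh_arrows_def finite_wnodes sum.If_cases Int_def)
    also have "{e\<in>{e\<in>W. col e = k}. e \<noteq> x \<and> snd e = snd x}
        = {e\<in>column m (snd x). col e = k \<and> e \<noteq> x}"
      using that by (auto simp: column_def wnodes_def)
    finally show ?thesis .
  qed
  have "(\<Sum>e\<in>{e\<in>W. col e = k}. inh_arrows e c) = (\<Sum>e\<in>{e\<in>W. col e = k}. inh_arrows e d)"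
    using bal assms unfolding balanced_def by blast
  then show ?thesis
    using assms card_remove_fibre[OF finite_column wnodes_in_column[OF assms(1)], of col k]
      card_remove_fibre[OF finite_column wnodes_in_column[OF assms(2)], of col k]
    by (simp add: sum)
qed

definition special :: "nat \<times> nat \<Rightarrow> bool" where
  "special v \<longleftrightarrow> v \<in> pattern_nodes n g \<or> v \<in> pattern_nodes n h"

text \<open>This expresses lying on a pattern through arrows, which balance controls.\<close>

lemma special_iff_exc_input: "special c \<longleftrightarrow> (\<exists>e\<in>W. 0 < exc_arrows n F e c)"
proof
  assume "special c"
  then obtain p where p: "p \<in> F" "c \<in> pattern_nodes n p"
    by (auto simp: special_def)
  \<comment> \<open>A second column exists as \<open>2 \<le> n\<close>; the node of \<open>p\<close>
    there sends an arrow to \<open>c\<close>.\<close>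
  obtain j where j: "j \<in> {1..n}" "j \<noteq> snd c"
    using n by (cases "snd c = 1") (force intro: that[of 2], force intro: that[of 1])
  have "(p j, j) \<in> W" using p g h j pattern_node_in_wnodes by blast
  moreover have "0 < exc_arrows n F (p j, j) c"
    using p j by (auto simp: exc_arrows_two mem_pattern_nodes)
  ultimately show "\<exists>e\<in>W. 0 < exc_arrows n F e c" by blast
qed (auto simp: exc_arrows_two special_def split: if_splits)

lemma special_color_invariant:
  assumes "c \<in> W" "d \<in> W" "col c = col d" "special c"
  shows "special d"
proof -
  obtain e where e: "e \<in> W" "0 < exc_arrows n F e c"
    using assms(4) special_iff_exc_input by blast
  let ?K = "{x\<in>W. col x = col e}"
  have "(\<Sum>x\<in>?K. exc_arrows n F x c) = (\<Sum>x\<in>?K. exc_arrows n F x d)"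
    using bal assms unfolding balanced_def by blast
  moreover have "exc_arrows n F e c \<le> (\<Sum>x\<in>?K. exc_arrows n F x c)"
    using e finite_wnodes by (intro member_le_sum) auto
  then have "(\<Sum>x\<in>?K. exc_arrows n F x c) \<noteq> 0"
    using e(2) by linarith
  ultimately have "\<exists>x\<in>?K. exc_arrows n F x d \<noteq> 0"
    by (metis (no_types, lifting) sum.neutral)
  then show ?thesis
    using special_iff_exc_input by auto
qed

text \<open>A node on only one pattern receives exactly one excitatory arrow from each other node of
  that pattern, so its inputs by colour, plus its own colour, count the colours of the whole
  pattern.\<close>

lemma pattern_color_counts:
  assumes c: "c \<in> pattern_nodes n g" "c \<notin> pattern_nodes n h"
    and d: "d \<in> pattern_nodes n h" "d \<notin> pattern_nodes n g"
    and "col c = col d"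
  shows "card {j\<in>{1..n}. col (g j, j) = k} = card {j\<in>{1..n}. col (h j, j) = k}"
proof -
  have sum: "(\<Sum>e\<in>{e\<in>W. col e = k}. exc_arrows n F e x) + of_bool (col x = k)
      = card {j\<in>{1..n}. col (p j, j) = k}"
    if "p \<in> patterns m n" "x \<in> pattern_nodes n p"
      and exc: "\<And>e. exc_arrows n F e x = (if e \<noteq> x \<and> e \<in> pattern_nodes n p then 1 else 0)" for x p
  proof -
    have "(\<Sum>e\<in>{e\<in>W. col e = k}. exc_arrows n F e x)
        = card {e\<in>{e\<in>W. col e = k}. e \<noteq> x \<and> e \<in> pattern_nodes n p}"
      by (simp add: exc finite_wnodes sum.If_cases Int_def)
    also have "{e\<in>{e\<in>W. col e = k}. e \<noteq> x \<and> e \<in> pattern_nodes n p}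
        = {e\<in>pattern_nodes n p. col e = k \<and> e \<noteq> x}"
      using pattern_nodes_subset[OF that(1)] by auto
    also have "card \<dots> + of_bool (col x = k) = card {e\<in>pattern_nodes n p. col e = k}"
      using that(2) finite_subset[OF pattern_nodes_subset[OF that(1)] finite_wnodes]
      by (simp add: card_remove_fibre)
    also have "{e\<in>pattern_nodes n p. col e = k} = (\<lambda>j. (p j, j)) ` {j\<in>{1..n}. col (p j, j) = k}"
      by (auto simp: pattern_nodes_def)
    also have "card \<dots> = card {j\<in>{1..n}. col (p j, j) = k}"
      by (intro card_image inj_onI) auto
    finally show ?thesis .
  qed
  have "c \<in> W" "d \<in> W"
    using c d pattern_nodes_subset g h by blast+
  then have "(\<Sum>e\<in>{e\<in>W. col e = k}. exc_arrows n F e c) = (\<Sum>e\<in>{e\<in>W. col e = k}. exc_arrows n F e d)"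
    using bal \<open>col c = col d\<close> unfolding balanced_def by blast
  moreover have exc_c: "exc_arrows n F e c = (if e \<noteq> c \<and> e \<in> pattern_nodes n g then 1 else 0)"
      and exc_d: "exc_arrows n F e d = (if e \<noteq> d \<and> e \<in> pattern_nodes n h then 1 else 0)" for e
    using c d by (auto simp: exc_arrows_two)
  ultimately show ?thesis
    using sum[OF g c(1) exc_c] sum[OF h d(1) exc_d] unfolding \<open>col c = col d\<close> by linarith
qed

text \<open>The two columns have equal colour counts. Colours separate pattern nodes from the
  others, so the counts also agree on the pattern nodes, and a colour-preserving bijection between
  these sets of at most two nodes either respects or crosses the patterns.\<close>

lemma columns_sharing_color:
  assumes cd: "c \<in> W" "d \<in> W" "col c = col d" and j: "snd c = j" "snd d = j'"
  shows "g j = h j \<longleftrightarrow> g j' = h j'"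
    and "col (g j, j) = col (g j', j') \<and> col (h j, j) = col (h j', j') \<or>
      col (g j, j) = col (h j', j') \<and> col (h j, j) = col (g j', j')"
proof -
  have jn: "j \<in> {1..n}" "j' \<in> {1..n}" using cd j by (auto simp: wnodes_def)
  let ?S = "\<lambda>j. {(g j, j), (h j, j)}"
  \<comment> \<open>The colours of pattern nodes: within a column, the pattern nodes of colour
    \<open>k\<close> are all nodes of colour \<open>k\<close> if \<open>Q k\<close> holds, and none
    otherwise.\<close>
  define Q where "Q k \<longleftrightarrow> (\<exists>e\<in>W. special e \<and> col e = k)" for k
  have S: "{e \<in> ?S i. col e = k} = (if Q k then {e\<in>column m i. col e = k} else {})"
    if i: "i \<in> {1..n}" for i k
  proof -
    have sp: "?S i = {e\<in>column m i. special e}"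
      using i pattern_node_in_column[of g i] pattern_node_in_column[of h i]
      by (auto simp: special_def mem_pattern_nodes column_def)
    show ?thesis
      using special_color_invariant column_subset_wnodes[OF i, of m] unfolding sp Q_def
      by (auto simp: subset_iff)
  qed
  have "card {e\<in>?S j. col e = k} = card {e\<in>?S j'. col e = k}" for k
    using column_color_counts[OF cd, of k] j unfolding S[OF jn(1)] S[OF jn(2)] by simp
  then obtain f where f: "bij_betw f (?S j) (?S j')" "\<And>x. x \<in> ?S j \<Longrightarrow> col (f x) = col x"
    using ex_label_bij[of "?S j" "?S j'" col col] by auto
  have "card (?S j) = card (?S j')" using f(1) by (rule bij_betw_same_card)
  then show "g j = h j \<longleftrightarrow> g j' = h j'" by (auto simp: card_insert_if split: if_splits)
  have im: "f ` ?S j = ?S j'" using f(1) by (simp add: bij_betw_def)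
  then have "f (g j, j) = (g j', j') \<and> f (h j, j) = (h j', j') \<or>
      f (g j, j) = (h j', j') \<and> f (h j, j) = (g j', j')"
    by (auto simp: doubleton_eq_iff)
  then show "col (g j, j) = col (g j', j') \<and> col (h j, j) = col (h j', j') \<or>
      col (g j, j) = col (h j', j') \<and> col (h j, j) = col (g j', j')"
    using f(2)[of "(g j, j)"] f(2)[of "(h j, j)"] by auto
qed

section \<open>Assembling automorphisms column by column\<close>

text \<open>The pair \<open>g'\<close>, \<open>h'\<close> records whether the patterns are kept or
  interchanged. The images of the two pattern nodes and of \<open>c\<close> are prescribed, and
  equal colour counts let this partial map be extended. The equivalences between \<open>c\<close>
  and \<open>d\<close> make it well defined and injective.\<close>

lemma ex_column_bij:
  assumes gh: "g' = g \<and> h' = h \<or> g' = h \<and> h' = g"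
    and j: "j \<in> {1..n}" "j' \<in> {1..n}"
    and col: "col (g j, j) = col (g' j', j')" "col (h j, j) = col (h' j', j')"
    and c: "c \<in> column m j" "d \<in> column m j'" "col c = col d"
      "c = (g j, j) \<longleftrightarrow> d = (g' j', j')" "c = (h j, j) \<longleftrightarrow> d = (h' j', j')"
  obtains f where "bij_betw f (column m j) (column m j')"
    "\<And>x. x \<in> column m j \<Longrightarrow> col (f x) = col x"
    "f (g j, j) = (g' j', j')" "f (h j, j) = (h' j', j')" "f c = d"
proof -
  have inW: "c \<in> W" "d \<in> W" and snd: "snd c = j" "snd d = j'"
    using c j column_subset_wnodes by (auto simp: column_def wnodes_def)
  have agree: "g j = h j \<longleftrightarrow> g' j' = h' j'"
    using columns_sharing_color(1)[OF inW c(3) snd] gh by auto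
  \<comment> \<open>The last branch matters only when \<open>c\<close> is off both patterns;
    otherwise the equivalences identify \<open>d\<close> with the matching pattern node.\<close>
  define f0 where "f0 x = (if x = (g j, j) then (g' j', j') else if x = (h j, j) then (h' j', j') else d)" for x
  let ?S = "{(g j, j), (h j, j), c}"
  have f0: "f0 (g j, j) = (g' j', j')" "f0 (h j, j) = (h' j', j')" "f0 c = d"
    using agree c by (auto simp: f0_def)
  have S1: "?S \<subseteq> column m j" using c j pattern_node_in_column by auto
  have S2: "inj_on f0 ?S"
  proof (intro inj_onI)
    fix x y assume "x \<in> ?S" "y \<in> ?S" "f0 x = f0 y"
    then show "x = y"
      unfolding insert_iff empty_iff using f0 agree c(4,5) prod.inject by metis
  qed
  have S3: "f0 ` ?S \<subseteq> column m j'"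
    using f0 c j gh pattern_node_in_column[of g j'] pattern_node_in_column[of h j'] by auto
  have S4: "col (f0 x) = col x" if "x \<in> ?S" for x
    using that f0 col c by auto
  obtain f where f: "bij_betw f (column m j) (column m j')"
    "\<And>x. x \<in> column m j \<Longrightarrow> col (f x) = col x" "\<And>x. x \<in> ?S \<Longrightarrow> f x = f0 x"
    using ex_label_bij_extending[where p = col and q = col, OF finite_column finite_column
        column_color_counts[OF inW c(3), unfolded snd] S1 S2 S3 S4] by blast
  show ?thesis using f f0 by (intro that[of f]) auto
qed

text \<open>Moving whole columns by \<open>\<pi>\<close> preserves inhibitory arrows. The map
  carries \<open>g\<close> to \<open>g'\<close> and \<open>h\<close> to \<open>h'\<close>, hence
  permutes the patterns of \<open>F\<close> and preserves excitatory multiplicities.\<close>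

lemma glue_column_bijs:
  assumes gh: "g' = g \<and> h' = h \<or> g' = h \<and> h' = g"
    and \<pi>: "bij_betw \<pi> {1..n} {1..n}"
    and f: "\<And>j. j \<in> {1..n} \<Longrightarrow> bij_betw (f j) (column m j) (column m (\<pi> j))"
    and fg: "\<And>j. j \<in> {1..n} \<Longrightarrow> f j (g j, j) = (g' (\<pi> j), \<pi> j)"
    and fh: "\<And>j. j \<in> {1..n} \<Longrightarrow> f j (h j, j) = (h' (\<pi> j), \<pi> j)"
  shows "(\<lambda>v. if v \<in> W then f (snd v) v else v) \<in> wilson_aut m n F" (is "?s \<in> _")
proof -
  have snd_W: "snd v \<in> {1..n}" if "v \<in> W" for v using that by (auto simp: wnodes_def)
  have \<pi>_in: "\<pi> j \<in> {1..n}" if "j \<in> {1..n}" for j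
    using that bij_betwE[OF \<pi>] by blast
  have s_col: "?s v \<in> column m (\<pi> (snd v))" if "v \<in> W" for v
    using that bij_betwE[OF f[OF snd_W[OF that]]] wnodes_in_column[OF that] by auto
  have s_W: "?s v \<in> W" if "v \<in> W" for v
    using column_subset_wnodes[OF \<pi>_in[OF snd_W[OF that]]] s_col[OF that] by (rule subsetD)
  have s_snd: "snd (?s v) = \<pi> (snd v)" if "v \<in> W" for v
    using s_col[OF that] by (simp only: column_def mem_Times_iff singleton_iff)
  have \<pi>_eq: "\<pi> (snd a) = \<pi> (snd b) \<longleftrightarrow> snd a = snd b" if "a \<in> W" "b \<in> W" for a b
    using that snd_W bij_betw_imp_inj_on[OF \<pi>] by (metis inj_on_eq_iff)
  have s_eq: "?s a = ?s b \<longleftrightarrow> a = b" if ab: "a \<in> W" "b \<in> W" for a b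
  proof
    assume eq: "?s a = ?s b"
    then have "snd a = snd b" using s_snd[OF ab(1)] s_snd[OF ab(2)] \<pi>_eq[OF ab] by metis
    moreover from this have "f (snd a) a = f (snd a) b" using eq ab by simp
    ultimately show "a = b"
      using inj_onD[OF bij_betw_imp_inj_on[OF f[OF snd_W[OF ab(1)]]]] ab wnodes_in_column by metis
  qed simp
  have "inj_on ?s W" using s_eq by (intro inj_onI) blast
  moreover have "?s ` W \<subseteq> W" using s_W by blast
  ultimately have "bij_betw ?s W W"
    unfolding bij_betw_def using endo_inj_surj[OF finite_wnodes] by blast
  then have perm: "?s permutes W" by (rule bij_imp_permutes) simp
  have s_pat: "?s v \<in> pattern_nodes n p' \<longleftrightarrow> v \<in> pattern_nodes n p"
    if v: "v \<in> W" and p: "p \<in> patterns m n"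
      and fp: "\<And>j. j \<in> {1..n} \<Longrightarrow> f j (p j, j) = (p' (\<pi> j), \<pi> j)" for p p' v
  proof -
    let ?j = "snd v"
    have j: "?j \<in> {1..n}" using v by (rule snd_W)
    have pj: "(p ?j, ?j) \<in> W" using p j by (rule pattern_node_in_wnodes)
    have "?s v \<in> pattern_nodes n p' \<longleftrightarrow> ?s v = (p' (\<pi> ?j), \<pi> ?j)"
      using s_snd[OF v] \<pi>_in[OF j] by (cases "?s v") (auto simp: mem_pattern_nodes)
    \<comment> \<open>The \<open>p'\<close> node of the target column is the image of the
      \<open>p\<close> node of the source column, so injectivity of the map decides
      membership.\<close>
    also have "\<dots> \<longleftrightarrow> ?s v = ?s (p ?j, ?j)" using fp[OF j] pj by simp
    also have "\<dots> \<longleftrightarrow> v = (p ?j, ?j)" using s_eq[OF v pj] .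
    also have "\<dots> \<longleftrightarrow> v \<in> pattern_nodes n p"
      using j by (cases v) (auto simp: mem_pattern_nodes)
    finally show ?thesis .
  qed
  have s_g: "?s v \<in> pattern_nodes n g' \<longleftrightarrow> v \<in> pattern_nodes n g"
    and s_h: "?s v \<in> pattern_nodes n h' \<longleftrightarrow> v \<in> pattern_nodes n h" if "v \<in> W" for v
    using s_pat[OF that g, of g'] s_pat[OF that h, of h'] fg fh by blast+
  have "inh_arrows (?s a) (?s b) = inh_arrows a b" if "a \<in> W" "b \<in> W" for a b
    unfolding inh_arrows_def s_eq[OF that] s_snd[OF that(1)] s_snd[OF that(2)] \<pi>_eq[OF that] ..
  moreover have "exc_arrows n F (?s a) (?s b) = exc_arrows n F a b" if ab: "a \<in> W" "b \<in> W" for a b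
  proof -
    have F': "F = {g', h'}" and neq: "g' = h' \<longleftrightarrow> g = h" using gh by auto
    have "exc_arrows n F (?s a) (?s b) = exc_arrows n {g', h'} (?s a) (?s b)"
      by (simp only: F')
    also have "\<dots> = exc_arrows n {g, h} a b"
      unfolding exc_arrows_two s_eq[OF ab]
        s_g[OF ab(1)] s_g[OF ab(2)] s_h[OF ab(1)] s_h[OF ab(2)] neq ..
    finally show ?thesis .
  qed
  ultimately show ?thesis
    using perm unfolding wilson_aut_def by blast
qed

section \<open>Keeping or interchanging the patterns\<close>

text \<open>Equal totals for each colour suffice because a colour occurring on a pattern node
  determines the unordered pair of colours on the pattern nodes of its column. For
  \<open>u \<noteq> v\<close>, counting ordered pairs thus reduces to counting the columns where
  \<open>g\<close>, respectively \<open>h\<close>, has colour \<open>u\<close>.\<close>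

lemma swapped_pair_counts:
  assumes cnt: "\<And>k. card {j\<in>{1..n}. col (g j, j) = k} = card {j\<in>{1..n}. col (h j, j) = k}"
  shows "card {j\<in>{1..n}. (col (g j, j), col (h j, j)) = l} = card {j\<in>{1..n}. (col (h j, j), col (g j, j)) = l}"
proof -
  obtain u v where l: "l = (u, v)" by (cases l)
  let ?A = "{j\<in>{1..n}. (col (g j, j), col (h j, j)) = l}"
  let ?B = "{j\<in>{1..n}. (col (h j, j), col (g j, j)) = l}"
  show ?thesis
  proof (cases "u = v \<or> ?A \<union> ?B = {}")
    case True
    then show ?thesis
    proof
      assume "u = v"
      then have "?A = ?B" using l by auto
      then show ?thesis by simp
    next
      assume "?A \<union> ?B = {}"
      then have "?A = {}" "?B = {}" by blast+
      then show ?thesis by (simp only:)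
    qed
  next
    case False
    then have "u \<noteq> v" and "?A \<union> ?B \<noteq> {}" by auto
    \<comment> \<open>The witness column \<open>i\<close> fixes the partner \<open>v\<close> of the
      colour \<open>u\<close>; every other column with \<open>u\<close> on a pattern node is
      compared with it.\<close>
    then obtain i where i: "i \<in> {1..n}"
      "col (g i, i) = u \<and> col (h i, i) = v \<or> col (h i, i) = u \<and> col (g i, i) = v"
      using l by auto
    have pair: "{col (g j, j), col (h j, j)} = {u, v}"
      if j: "j \<in> {1..n}" and p: "p \<in> F" "col (p j, j) = u" for j p
    proof -
      obtain q where q: "q \<in> F" "col (q i, i) = u" using i(2) by auto
      have "(p j, j) \<in> W" "(q i, i) \<in> W"
        using p q i j g h pattern_node_in_wnodes by blast+
      then have "{col (g j, j), col (h j, j)} = {col (g i, i), col (h i, i)}"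
        using columns_sharing_color(2)[of "(p j, j)" "(q i, i)" j i] p(2) q(2)
        unfolding doubleton_eq_iff snd_conv by metis
      also have "\<dots> = {u, v}" using i(2) unfolding doubleton_eq_iff by metis
      finally show ?thesis .
    qed
    have "?A = {j\<in>{1..n}. col (g j, j) = u}"
      using pair[of _ g] l \<open>u \<noteq> v\<close> by (auto simp: doubleton_eq_iff)
    moreover have "?B = {j\<in>{1..n}. col (h j, j) = u}"
      using pair[of _ h] l \<open>u \<noteq> v\<close> by (auto simp: doubleton_eq_iff)
    ultimately show ?thesis using cnt by simp
  qed
qed

text \<open>The patterns are interchanged only if keeping them fails. In that case a node only on
  \<open>g\<close> shares its colour with one only on \<open>h\<close>, and balance supplies the
  equal counts that an interchange requires.\<close>

lemma ex_aligned_patterns: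
  assumes cd: "c \<in> W" "d \<in> W" "col c = col d" and j: "snd c = j" "snd d = j'"
  obtains g' h' where "g' = g \<and> h' = h \<or>
      g' = h \<and> h' = g \<and> (\<forall>k. card {j\<in>{1..n}. col (g j, j) = k} = card {j\<in>{1..n}. col (h j, j) = k})"
    "col (g j, j) = col (g' j', j')" "col (h j, j) = col (h' j', j')"
    "c = (g j, j) \<longleftrightarrow> d = (g' j', j')" "c = (h j, j) \<longleftrightarrow> d = (h' j', j')"
proof -
  have jn: "j \<in> {1..n}" "j' \<in> {1..n}" using cd j by (auto simp: wnodes_def)
  have agree: "(g j, j) = (h j, j) \<longleftrightarrow> (g j', j') = (h j', j')"
    using columns_sharing_color(1)[OF cd j] by simp
  note cols = columns_sharing_color(2)[OF cd j]
  have sp: "special c \<longleftrightarrow> c = (g j, j) \<or> c = (h j, j)"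
    "special d \<longleftrightarrow> d = (g j', j') \<or> d = (h j', j')"
    using jn j by (cases c; cases d; auto simp: special_def mem_pattern_nodes)+
  have sp_iff: "special c \<longleftrightarrow> special d"
    using special_color_invariant cd by metis
  have counts: "card {j\<in>{1..n}. col (g j, j) = k} = card {j\<in>{1..n}. col (h j, j) = k}"
    if "g j \<noteq> h j" "col (g j, j) = col (h j', j')" for k
    using that agree jn
    by (intro pattern_color_counts[of "(g j, j)" "(h j', j')"]) (auto simp: mem_pattern_nodes)
  note goal = that
  have swap: thesis if swapped: "(g j, j) \<noteq> (h j, j)" "col (g j, j) = col (h j', j')" "col (h j, j) = col (g j', j')"
    "c = (g j, j) \<longleftrightarrow> d = (h j', j')" "c = (h j, j) \<longleftrightarrow> d = (g j', j')"
    using swapped counts by (intro goal[of h g]) auto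
  show thesis
  proof (cases "col (g j, j) = col (g j', j') \<and> col (h j, j) = col (h j', j') \<and>
      (c = (g j, j) \<longleftrightarrow> d = (g j', j')) \<and> (c = (h j, j) \<longleftrightarrow> d = (h j', j'))")
    case True
    then show ?thesis by (intro that[of g h]) auto
  next
    case False
    show ?thesis
      \<comment> \<open>If the patterns coincided in column \<open>j\<close>, keeping them would
        work. If the colours cannot be matched straight, they match crosswise, and so do the
        positions of \<open>c\<close> and \<open>d\<close>. If only the positions fail,
        \<open>col c = col d\<close> makes all four pattern nodes equal in colour, so crossing works
        too.\<close>
      by (rule swap; use False sp sp_iff agree cols cd(3) in \<open>smt (verit)\<close>)
  qed
qed

section \<open>Transitivity on colour classes\<close>

lemma color_preserving_transitive:
  assumes cd: "c \<in> W" "d \<in> W" "col c = col d"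
  shows "\<exists>\<sigma>\<in>wilson_aut m n F. (\<forall>v\<in>W. col (\<sigma> v) = col v) \<and> \<sigma> c = d"
proof -
  define j j' where "j = snd c" and "j' = snd d"
  have jn: "j \<in> {1..n}" "j' \<in> {1..n}" using cd by (auto simp: j_def j'_def wnodes_def)
  obtain g' h' where gh': "g' = g \<and> h' = h \<or>
      g' = h \<and> h' = g \<and> (\<forall>k. card {j\<in>{1..n}. col (g j, j) = k} = card {j\<in>{1..n}. col (h j, j) = k})"
    and col: "col (g j, j) = col (g' j', j')" "col (h j, j) = col (h' j', j')"
    and fit: "c = (g j, j) \<longleftrightarrow> d = (g' j', j')" "c = (h j, j) \<longleftrightarrow> d = (h' j', j')"
    by (rule ex_aligned_patterns[OF cd j_def[symmetric] j'_def[symmetric]])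
  have gh: "g' = g \<and> h' = h \<or> g' = h \<and> h' = g" using gh' by blast
  \<comment> \<open>Columns are labelled by ordered pairs of pattern colours; a label-respecting
    \<open>\<pi>\<close> with \<open>\<pi> j = j'\<close> then moves the columns compatibly with the
    chosen alignment.\<close>
  let ?P = "\<lambda>i. (col (g i, i), col (h i, i))" and ?P' = "\<lambda>i. (col (g' i, i), col (h' i, i))"
  have "card {i\<in>{1..n}. ?P i = l} = card {i\<in>{1..n}. ?P' i = l}" for l
    using gh' swapped_pair_counts[of l] by auto
  then obtain \<pi> where \<pi>: "bij_betw \<pi> {1..n} {1..n}" "\<And>i. i \<in> {1..n} \<Longrightarrow> ?P' (\<pi> i) = ?P i" "\<pi> j = j'"
    using ex_label_bij_extending[of "{1..n}" "{1..n}" ?P ?P' "{j}" "\<lambda>_. j'"] jn col by auto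
  have "\<exists>f. bij_betw f (column m i) (column m (\<pi> i)) \<and> (\<forall>x\<in>column m i. col (f x) = col x) \<and>
      f (g i, i) = (g' (\<pi> i), \<pi> i) \<and> f (h i, i) = (h' (\<pi> i), \<pi> i) \<and> (i = j \<longrightarrow> f c = d)"
    if i: "i \<in> {1..n}" for i
  proof -
    have \<pi>i: "\<pi> i \<in> {1..n}" using bij_betwE[OF \<pi>(1)] i by blast
    have coli: "col (g i, i) = col (g' (\<pi> i), \<pi> i)" "col (h i, i) = col (h' (\<pi> i), \<pi> i)"
      using \<pi>(2)[OF i] by auto
    show ?thesis
    proof (cases "i = j")
      case True
      have "c \<in> column m j" "d \<in> column m j'"
        using cd wnodes_in_column by (auto simp: j_def j'_def)
      then obtain f where "bij_betw f (column m j) (column m j')"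
        "\<And>x. x \<in> column m j \<Longrightarrow> col (f x) = col x"
        "f (g j, j) = (g' j', j')" "f (h j, j) = (h' j', j')" "f c = d"
        using ex_column_bij[OF gh jn col _ _ cd(3) fit] by metis
      then show ?thesis using True \<pi>(3) by auto
    next
      case False
      have inW: "(g i, i) \<in> W" "(g' (\<pi> i), \<pi> i) \<in> W"
        using i \<pi>i gh g h pattern_node_in_wnodes by blast+
      have agree: "g i = h i \<longleftrightarrow> g (\<pi> i) = h (\<pi> i)"
        using columns_sharing_color(1)[OF inW coli(1)] by simp
      have incol: "(g i, i) \<in> column m i" "(g' (\<pi> i), \<pi> i) \<in> column m (\<pi> i)"
        using inW by (auto simp: mem_column_iff)
      \<comment> \<open>Away from column \<open>j\<close> no further node is prescribed, so the
        \<open>g\<close> node and its target take the places of \<open>c\<close> and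
        \<open>d\<close> in \<open>ex_column_bij\<close>.\<close>
      have "(g i, i) = (h i, i) \<longleftrightarrow> (g' (\<pi> i), \<pi> i) = (h' (\<pi> i), \<pi> i)"
        using agree gh by auto
      then obtain f where "bij_betw f (column m i) (column m (\<pi> i))"
        "\<And>x. x \<in> column m i \<Longrightarrow> col (f x) = col x"
        "f (g i, i) = (g' (\<pi> i), \<pi> i)" "f (h i, i) = (h' (\<pi> i), \<pi> i)"
        using ex_column_bij[OF gh i \<pi>i coli incol coli(1)] by metis
      then show ?thesis using False by auto
    qed
  qed
  then obtain f where f: "\<And>i. i \<in> {1..n} \<Longrightarrow> bij_betw (f i) (column m i) (column m (\<pi> i)) \<and>
      (\<forall>x\<in>column m i. col (f i x) = col x) \<and>
      f i (g i, i) = (g' (\<pi> i), \<pi> i) \<and> f i (h i, i) = (h' (\<pi> i), \<pi> i) \<and> (i = j \<longrightarrow> f i c = d)"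
    by metis
  let ?s = "\<lambda>v. if v \<in> W then f (snd v) v else v"
  have "?s \<in> wilson_aut m n F"
    using f by (intro glue_column_bijs[OF gh \<pi>(1)]) auto
  moreover have "col (?s v) = col v" if "v \<in> W" for v
  proof -
    have "snd v \<in> {1..n}" using that by (auto simp: wnodes_def)
    then show ?thesis using f wnodes_in_column[OF that] that by simp
  qed
  moreover have "?s c = d" using f[OF jn(1)] cd(1) by (simp add: j_def)
  ultimately show ?thesis by (intro bexI[of _ ?s]) auto
qed

end

theorem theorem6p5:
  fixes m n :: nat and F :: "(nat \<Rightarrow> nat) set" and col :: "nat \<times> nat \<Rightarrow> 'c"
  assumes "F \<subseteq> patterns m n"
    and "card F = 1 \<or> card F = 2"
    and "balanced m n F col"
  shows "orbit_coloring m n F col"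
proof (cases "n \<le> 1")
  case True
  then show ?thesis by (rule orbit_coloring_single_column)
next
  case False
  \<comment> \<open>Cardinality one is covered by \<open>g = h\<close>.\<close>
  obtain g h where F: "F = {g, h}"
    using assms(2) by (metis card_1_singletonE card_2_iff insert_absorb2)
  interpret two_patterns m n g h col
    using assms False F by unfold_locales auto
  show ?thesis
    unfolding F by (rule orbit_coloring_if_transitive) (rule color_preserving_transitive)
qed

end
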